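(* Let $\mathcal{P}$ be a set of participants, $G$ a bounded global type, $N$ a network and $M$ a queue. If $\vdash_{\mathcal{P}} G : N \parallel M$ is derivable (with empty history), then the session $N\parallel M$ is $\mathcal{P}$-orphan-message-free.
   Context: Labels are ranged over by $\lambda$, participants by $p,q,r,s$. Processes are the possibly infinite but regular (finitely many distinct subterms) terms coinductively generated by $P ::= \mathbf{0} \mid q!\{\lambda_i.P_i\}_{i\in I} \mid q?\{\lambda_i.P_i\}_{i\in I}$, with $I$ finite and nonempty and the $\lambda_i$ pairwise distinct; $q!\{\lambda_i.P_i\}$ sends one of the $\lambda_i$ to $q$ and continues as $P_i$, $q?\{\lambda_i.P_i\}$ waits to receive one of the $\lambda_i$ from $q$ and continues as $P_i$. $\mathrm{plays}(P)$ is the smallest set with $\mathrm{plays}(\mathbf{0})=\emptyset$ and $\mathrm{plays}(q!\{\lambda_i.P_i\}_{i\in I})=\mathrm{plays}(q?\{\lambda_i.P_i\}_{i\in I})=\{q\}\cup\bigcup_{i\in I}\mathrm{plays}(P_i)$. A message is a triple $(p,\lambda,q)$ (sender $p$, label $\lambda$, receiver $q$). A queue $M$ is a finite sequence of messages ($\emptyset$ empty, $\cdot$ concatenation), taken modulo the equivalence that swaps two adjacent messages $(p,\lambda,q)$ and $(r,\lambda',s)$ whenever $p\neq r$ or $q\neq s$. A network is $N=p_1[P_1]\parallel\cdots\parallel p_n[P_n]$ with the $p_h$ pairwise distinct and $p_h\notin\mathrm{plays}(P_h)$, taken modulo permutation of components and adding/removing components $p[\mathbf{0}]$. We write $p[P]\in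 N$ if $P\neq\mathbf{0}$ and $N\equiv p[P]\parallel N'$ for some $N'$; $\mathrm{Plays}(N)=\{p\mid p[P]\in N\}$. A session is $N\parallel M$. Communications $\beta$ are $pq!\lambda$ ($p$ sends $\lambda$ to $q$) or $pq?\lambda$ ($p$ reads $\lambda$ sent by $q$), with $\mathrm{play}(pq!\lambda)=\mathrm{play}(pq?\lambda)=p$. The session transition relation is given by: (Send) $p[q!\{\lambda_i.P_i\}_{i\in I}]\parallel N\parallel M \xrightarrow{pq!\lambda_h} p[P_h]\parallel N\parallel M\cdot(p,\lambda_h,q)$ for $h\in I$; (Rcv) $p[q?\{\lambda_i.P_i\}_{i\in I}]\parallel N\parallel (q,\lambda_h,p)\cdot M \xrightarrow{pq?\lambda_h} p[P_h]\parallel N\parallel M$ for $h\in I$. For a finite trace $\tau=\beta_1\cdots\beta_n$, $\xrightarrow{\tau}$ is the composition of the $\xrightarrow{\beta_i}$ (identity for the empty trace), and $S\xrightarrow{\tau}$ means $S\xrightarrow{\tau}S'$ for some $S'$. A session $N\parallel M$ is $pq$-orphan-message-free if whenever $N\parallel M\xrightarrow{\tau}N'\parallel (p,\lambda,q)\cdot M'$ there exists $\tau'$ with $N'\parallel (p,\lambda,q)\cdot M'\xrightarrow{\tau'\cdot qp?\lambda}$. It is $\mathcal{P}$-orphan-message-free if it is $pq$-orphan-message-free for every pair $p,q\in\mathcal{P}$. Global types are regular coinductive terms $G ::= pq!\{\lambda_i.G_i\}_{i\in I} \mid pq?\lambda.G \mid \mathsf{End}$ with $p\neq q$, $I$ nonempty,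 labels pairwise distinct; $pq!\{\lambda_i.G_i\}$ means $p$ sends some $\lambda_i$ to $q$ then $G_i$; $pq?\lambda.G$ means $p$ reads $\lambda$ sent by $q$ then $G$. $\mathrm{Plays}(G)$ is the smallest set with $\mathrm{Plays}(\mathsf{End})=\emptyset$, $\mathrm{Plays}(pq!\{\lambda_i.G_i\}_{i\in I})=\{p\}\cup\bigcup_i\mathrm{Plays}(G_i)$, $\mathrm{Plays}(pq?\lambda.G)=\{p\}\cup\mathrm{Plays}(G)$. $\mathrm{Paths}(G)$ is the greatest set of finite or infinite sequences of communications with $\mathrm{Paths}(\mathsf{End})=\{\epsilon\}$, $\mathrm{Paths}(pq!\{\lambda_i.G_i\}_{i\in I})=\bigcup_{i}\{pq!\lambda_i\cdot\xi\mid\xi\in\mathrm{Paths}(G_i)\}$, $\mathrm{Paths}(pq?\lambda.G)=\{pq?\lambda\cdot\xi\mid \xi\in\mathrm{Paths}(G)\}$; $\xi[n]$ is the $n$-th communication of $\xi$. $\mathrm{depth}(\xi,p)=\inf\{n\mid\mathrm{play}(\xi[n])=p\}$ (with $\inf\emptyset=\infty$); $\mathrm{depth}(G,p)=\sup\{\mathrm{depth}(\xi,p)\mid\xi\in\mathrm{Paths}(G)\}$ if $p\in\mathrm{Plays}(G)$, and $0$ otherwise. $G$ is bounded if $\mathrm{depth}(G',p)$ is finite for every $p\in\mathrm{Plays}(G)$ and every global type $G'$ occurring in $G$. Weight of a message: $\mathrm{wg}((p,\lambda,q),G)=0$ if $G=qp?\lambda.G'$; $=\infty$ if $G=\mathsf{End}$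 or $G=qp?\lambda'.G'$ with $\lambda'\neq\lambda$; $=1+\max_{i\in I}\mathrm{wg}((p,\lambda,q),G_i)$ if $G=rs!\{\lambda_i.G_i\}_{i\in I}$; $=1+\mathrm{wg}((p,\lambda,q),G')$ if $G=rs?\lambda'.G'$ with $r\neq q$ or $s\neq p$. A type configuration $G\parallel M$ is $\mathcal{P}$-sound if $\mathrm{wg}((p,\lambda,q),G)$ is finite for every message $(p,\lambda,q)$ occurring in $M$ with $\{p,q\}\subseteq\mathcal{P}$. A history $H$ is a finite set of pairs $(N\parallel M, G)$; $(N\parallel -,G)\in H$ means $(N\parallel M,G)\in H$ for some $M$; $H,(S,G)$ denotes $H\cup\{(S,G)\}$. Judgements $H\vdash_{\mathcal{P}} G : N\parallel M$ (with $G$ bounded) are derived inductively (finite derivations) by: (End) $H\vdash_{\mathcal{P}}\mathsf{End}:N\parallel M$ if $\mathrm{Plays}(N)\cap\mathcal{P}=\emptyset$ and $\mathsf{End}\parallel M$ is $\mathcal{P}$-sound. (Cycle) $H\vdash_{\mathcal{P}} G:N\parallel M$ if $(N\parallel M,G)\in H$. (Out) if $G=pq!\{\lambda_i.G_i\}_{i\in I}$, $P=q!\{\lambda_i.P_i\}_{i\in I}$, $G\parallel M$ is $\mathcal{P}$-sound, $(p[P]\parallel N\parallel -,G)\notin H$, $(\mathrm{Plays}(N)\setminus\mathrm{Plays}(G))\cap\mathcal{P}=\emptyset$, and $H,(p[P]\parallel N\parallel M,G)\vdash_{\mathcal{P}} G_i : p[P_i]\parallel N\parallel M\cdot(p,\lambda_i,q)$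 for all $i\in I$, then $H\vdash_{\mathcal{P}} G:p[P]\parallel N\parallel M$. (In) if $G=pq?\lambda_h.G'$, $P=q?\{\lambda_i.P_i\}_{i\in I}$ with $h\in I$, $G'\parallel M$ is $\mathcal{P}$-sound, $(p[P]\parallel N\parallel -,G)\notin H$, $(\mathrm{Plays}(N)\setminus\mathrm{Plays}(G))\cap\mathcal{P}=\emptyset$, and $H,(p[P]\parallel N\parallel M,G)\vdash_{\mathcal{P}}G':p[P_h]\parallel N\parallel M$, then $H\vdash_{\mathcal{P}} G : p[P]\parallel N\parallel (q,\lambda_h,p)\cdot M$. We write $\vdash_{\mathcal{P}} G:N\parallel M$ when the judgement is derivable with empty history.
   Formalization: In rule (In) the history of the premise is extended with the session of the conclusion, p[P] ∥ N ∥ (q,λ_h,p)·M, together with G, instead of the printed p[P] ∥ N ∥ M; with the printed rule the theorem is false. *)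

theory Defs
  imports Main "HOL-Library.Finite_Map" "HOL-Library.Extended_Nat"
begin

text \<open>
  The type variables \<open>'p\<close> and \<open>'l\<close> stand for arbitrary sets of participants and labels.
  A family of branches with pairwise distinct labels and finite index set is a finite map from
  labels to continuations; non-emptiness of the index set and regularity of the (possibly
  infinite) terms are imposed by \<open>wf_proc\<close> and \<open>wf_gtype\<close>.
\<close>

section \<open>Processes\<close>

codatatype ('p, 'l) proc =
    Inact
  | Send 'p "('l, ('p, 'l) proc) fmap"
  | Recv 'p "('l, ('p, 'l) proc) fmap"

inductive_set subprocs :: "('p, 'l) proc \<Rightarrow> ('p, 'l) proc set" for P where
  "P \<in> subprocs P"
| "Send q Ps \<in> subprocs P \<Longrightarrow> fmlookup Ps l = Some Q \<Longrightarrow> Q \<in> subprocs P"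
| "Recv q Ps \<in> subprocs P \<Longrightarrow> fmlookup Ps l = Some Q \<Longrightarrow> Q \<in> subprocs P"

definition wf_proc :: "('p, 'l) proc \<Rightarrow> bool" where
  "wf_proc P \<longleftrightarrow> finite (subprocs P) \<and>
     (\<forall>q Ps. Send q Ps \<in> subprocs P \<or> Recv q Ps \<in> subprocs P \<longrightarrow> Ps \<noteq> fmempty)"

inductive in_plays :: "'p \<Rightarrow> ('p, 'l) proc \<Rightarrow> bool" where
  "in_plays q (Send q Ps)"
| "in_plays q (Recv q Ps)"
| "fmlookup Ps l = Some P \<Longrightarrow> in_plays r P \<Longrightarrow> in_plays r (Send q Ps)"
| "fmlookup Ps l = Some P \<Longrightarrow> in_plays r P \<Longrightarrow> in_plays r (Recv q Ps)"

definition plays :: "('p, 'l) proc \<Rightarrow> 'p set" where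
  "plays P = {r. in_plays r P}"


section \<open>Queues\<close>

text \<open>A message is a triple of sender, label and receiver.\<close>

type_synonym ('p, 'l) message = "'p \<times> 'l \<times> 'p"

inductive queue_swap :: "('p, 'l) message list \<Rightarrow> ('p, 'l) message list \<Rightarrow> bool" where
  "p \<noteq> r \<or> q \<noteq> s \<Longrightarrow>
     queue_swap (ms @ [(p, l, q), (r, l', s)] @ ms') (ms @ [(r, l', s), (p, l, q)] @ ms')"

abbreviation queue_equiv :: "('p, 'l) message list \<Rightarrow> ('p, 'l) message list \<Rightarrow> bool" where
  "queue_equiv \<equiv> equivclp queue_swap"

quotient_type ('p, 'l) queue = "('p, 'l) message list" / queue_equiv
  by simp

lemma queue_swap_append:
  assumes "queue_swap xs ys"
  shows "queue_swap (us @ xs @ vs) (us @ ys @ vs)"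
  using assms
proof cases
  case (1 p r q s ms l l' ms')
  then show ?thesis
    using queue_swap.intros[of p r q s "us @ ms" l l' "ms' @ vs"] by simp
qed

lemma queue_equiv_append:
  assumes "queue_equiv xs ys"
  shows "queue_equiv (us @ xs @ vs) (us @ ys @ vs)"
  using assms
proof (induction rule: equivclp_induct)
  case base
  then show ?case by simp
next
  case (step y z)
  then have "queue_swap (us @ y @ vs) (us @ z @ vs) \<or> queue_swap (us @ z @ vs) (us @ y @ vs)"
    by (blast intro: queue_swap_append)
  with step.IH show ?case
    by (blast intro: equivclp_into_equivclp)
qed

lemma queue_equiv_set:
  assumes "queue_equiv xs ys"
  shows "set xs = set ys"
proof -
  have swap: "set ys = set zs" if "queue_swap ys zs" for ys zs :: "('a, 'b) message list"
    using that by cases auto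
  from assms show ?thesis
    by (induction rule: equivclp_induct) (metis swap)+
qed

lift_definition queue_append :: "('p, 'l) queue \<Rightarrow> ('p, 'l) queue \<Rightarrow> ('p, 'l) queue"
  (infixr "\<odot>" 65) is "(@)"
proof -
  fix xs xs' ys ys' :: "('p, 'l) message list"
  assume "queue_equiv xs xs'" "queue_equiv ys ys'"
  from this(1) have "queue_equiv (xs @ ys) (xs' @ ys)"
    using queue_equiv_append[of xs xs' "[]" ys] by simp
  also from \<open>queue_equiv ys ys'\<close> have "queue_equiv (xs' @ ys) (xs' @ ys')"
    using queue_equiv_append[of ys ys' xs' "[]"] by simp
  finally (equivclp_trans) show "queue_equiv (xs @ ys) (xs' @ ys')" .
qed

lift_definition single :: "('p, 'l) message \<Rightarrow> ('p, 'l) queue" is "\<lambda>m. [m]" .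

lift_definition messages :: "('p, 'l) queue \<Rightarrow> ('p, 'l) message set" is set
  by (rule queue_equiv_set)


section \<open>Networks and sessions\<close>

text \<open>
  Networks modulo permutation of components and addition or removal of components \<open>p[0]\<close> are
  finitely supported functions: \<open>N p\<close> is the process of \<open>p\<close>, and it is \<open>Inact\<close> if \<open>p\<close> has no
  component. If \<open>N p = Inact\<close>, then \<open>N(p := P)\<close> is the parallel composition of \<open>p[P]\<close> and \<open>N\<close>.
\<close>

type_synonym ('p, 'l) network = "'p \<Rightarrow> ('p, 'l) proc"

definition net_plays :: "('p, 'l) network \<Rightarrow> 'p set" where
  "net_plays N = {p. N p \<noteq> Inact}"

definition wf_network :: "('p, 'l) network \<Rightarrow> bool" where
  "wf_network N \<longleftrightarrow> finite (net_plays N) \<and> (\<forall>p. wf_proc (N p) \<and> p \<notin> plays (N p))"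

type_synonym ('p, 'l) session = "('p, 'l) network \<times> ('p, 'l) queue"

text \<open>\<open>CSend p q l\<close>: \<open>p\<close> sends \<open>l\<close> to \<open>q\<close>; \<open>CRecv p q l\<close>: \<open>p\<close> reads \<open>l\<close> sent by \<open>q\<close>.\<close>

datatype ('p, 'l) comm = CSend 'p 'p 'l | CRecv 'p 'p 'l

primrec play :: "('p, 'l) comm \<Rightarrow> 'p" where
  "play (CSend p q l) = p"
| "play (CRecv p q l) = p"

inductive step :: "('p, 'l) session \<Rightarrow> ('p, 'l) comm \<Rightarrow> ('p, 'l) session \<Rightarrow> bool" where
  Send: "N p = Inact \<Longrightarrow> fmlookup Ps l = Some P \<Longrightarrow>
    step (N(p := Send q Ps), M) (CSend p q l) (N(p := P), M \<odot> single (p, l, q))"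
| Rcv: "N p = Inact \<Longrightarrow> fmlookup Ps l = Some P \<Longrightarrow>
    step (N(p := Recv q Ps), single (q, l, p) \<odot> M) (CRecv p q l) (N(p := P), M)"

inductive steps :: "('p, 'l) session \<Rightarrow> ('p, 'l) comm list \<Rightarrow> ('p, 'l) session \<Rightarrow> bool" where
  Nil: "steps S [] S"
| Cons: "step S b S' \<Longrightarrow> steps S' t S'' \<Longrightarrow> steps S (b # t) S''"

definition orphan_message_free_pair :: "'p \<Rightarrow> 'p \<Rightarrow> ('p, 'l) session \<Rightarrow> bool" where
  "orphan_message_free_pair p q S \<longleftrightarrow>
     (\<forall>t N' l M'. steps S t (N', single (p, l, q) \<odot> M') \<longrightarrow>
        (\<exists>t' S'. steps (N', single (p, l, q) \<odot> M') (t' @ [CRecv q p l]) S'))"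

definition orphan_message_free :: "'p set \<Rightarrow> ('p, 'l) session \<Rightarrow> bool" where
  "orphan_message_free \<P> S \<longleftrightarrow> (\<forall>p\<in>\<P>. \<forall>q\<in>\<P>. orphan_message_free_pair p q S)"


section \<open>Global types\<close>

codatatype ('p, 'l) gtype =
    End
  | GSend 'p 'p "('l, ('p, 'l) gtype) fmap"
  | GRecv 'p 'p 'l "('p, 'l) gtype"

inductive_set subtypes :: "('p, 'l) gtype \<Rightarrow> ('p, 'l) gtype set" for G where
  "G \<in> subtypes G"
| "GSend p q Gs \<in> subtypes G \<Longrightarrow> fmlookup Gs l = Some G' \<Longrightarrow> G' \<in> subtypes G"
| "GRecv p q l G' \<in> subtypes G \<Longrightarrow> G' \<in> subtypes G"

definition wf_gtype :: "('p, 'l) gtype \<Rightarrow> bool" where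
  "wf_gtype G \<longleftrightarrow> finite (subtypes G) \<and>
     (\<forall>p q Gs. GSend p q Gs \<in> subtypes G \<longrightarrow> p \<noteq> q \<and> Gs \<noteq> fmempty) \<and>
     (\<forall>p q l G'. GRecv p q l G' \<in> subtypes G \<longrightarrow> p \<noteq> q)"

inductive in_gplays :: "'p \<Rightarrow> ('p, 'l) gtype \<Rightarrow> bool" where
  "in_gplays p (GSend p q Gs)"
| "in_gplays p (GRecv p q l G)"
| "fmlookup Gs l = Some G \<Longrightarrow> in_gplays r G \<Longrightarrow> in_gplays r (GSend p q Gs)"
| "in_gplays r G \<Longrightarrow> in_gplays r (GRecv p q l G)"

definition gplays :: "('p, 'l) gtype \<Rightarrow> 'p set" where
  "gplays G = {r. in_gplays r G}"


subsection \<open>Paths, depth and boundedness\<close>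

text \<open>Finite or infinite sequences.\<close>

codatatype 'a llist = LNil | LCons 'a "'a llist"

text \<open>\<open>lnth_opt \<xi> n\<close> is the \<open>n\<close>-th element of \<open>\<xi>\<close>, counting from 1, if it exists.\<close>

fun lnth_opt :: "'a llist \<Rightarrow> nat \<Rightarrow> 'a option" where
  "lnth_opt \<xi> 0 = None"
| "lnth_opt \<xi> (Suc 0) = (case \<xi> of LNil \<Rightarrow> None | LCons b \<xi>' \<Rightarrow> Some b)"
| "lnth_opt \<xi> (Suc (Suc n)) = (case \<xi> of LNil \<Rightarrow> None | LCons b \<xi>' \<Rightarrow> lnth_opt \<xi>' (Suc n))"

coinductive is_path :: "('p, 'l) gtype \<Rightarrow> ('p, 'l) comm llist \<Rightarrow> bool" where
  "is_path End LNil"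
| "fmlookup Gs l = Some G \<Longrightarrow> is_path G \<xi> \<Longrightarrow> is_path (GSend p q Gs) (LCons (CSend p q l) \<xi>)"
| "is_path G \<xi> \<Longrightarrow> is_path (GRecv p q l G) (LCons (CRecv p q l) \<xi>)"

definition paths :: "('p, 'l) gtype \<Rightarrow> ('p, 'l) comm llist set" where
  "paths G = {\<xi>. is_path G \<xi>}"

definition path_depth :: "('p, 'l) comm llist \<Rightarrow> 'p \<Rightarrow> enat" where
  "path_depth \<xi> p = Inf {enat n | n. \<exists>b. lnth_opt \<xi> n = Some b \<and> play b = p}"

definition depth :: "('p, 'l) gtype \<Rightarrow> 'p \<Rightarrow> enat" where
  "depth G p = (if p \<in> gplays G then SUP \<xi>\<in>paths G. path_depth \<xi> p else 0)"

definition bounded :: "('p, 'l) gtype \<Rightarrow> bool" where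
  "bounded G \<longleftrightarrow> (\<forall>p\<in>gplays G. \<forall>G'\<in>subtypes G. depth G' p \<noteq> \<infinity>)"


subsection \<open>Weight and soundness\<close>

text \<open>
  The recursive equations for the weight (lemma \<open>weight_simps\<close>) are not well-founded on infinite
  terms, but they have exactly one solution in the extended naturals (lemma \<open>weight_unique\<close>), which
  is introduced here as the least one. The supremum over the branches is a maximum, since there are
  finitely many and at least one of them.
\<close>

definition weight_step ::
  "('p, 'l) message \<Rightarrow> (('p, 'l) gtype \<Rightarrow> enat) \<Rightarrow> ('p, 'l) gtype \<Rightarrow> enat" where
  "weight_step = (\<lambda>(p, l, q) w G. case G of
       End \<Rightarrow> \<infinity>
     | GSend r s Gs \<Rightarrow> 1 + (SUP G'\<in>fmran' Gs. w G')
     | GRecv r s l' G' \<Rightarrow> if r = q \<and> s = p then (if l' = l then 0 else \<infinity>) else 1 + w G')"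

definition weight :: "('p, 'l) message \<Rightarrow> ('p, 'l) gtype \<Rightarrow> enat" where
  "weight m = lfp (weight_step m)"

lemma mono_weight_step: "mono (weight_step m)"
proof (rule monoI, rule le_funI)
  fix v w :: "('a, 'b) gtype \<Rightarrow> enat" and G
  assume "v \<le> w"
  then have "\<And>G. v G \<le> w G" by (simp add: le_fun_def)
  then show "weight_step m v G \<le> weight_step m w G"
    by (cases m; cases G) (auto simp: weight_step_def intro!: add_left_mono SUP_mono)
qed

lemma weight_unfold: "weight m = weight_step m (weight m)"
  unfolding weight_def by (rule lfp_unfold[OF mono_weight_step])

lemma weight_simps:
  "weight (p, l, q) End = \<infinity>"
  "weight (p, l, q) (GSend r s Gs) = 1 + (SUP G'\<in>fmran' Gs. weight (p, l, q) G')"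
  "weight (p, l, q) (GRecv q p l' G') = (if l' = l then 0 else \<infinity>)"
  "r \<noteq> q \<or> s \<noteq> p \<Longrightarrow> weight (p, l, q) (GRecv r s l' G') = 1 + weight (p, l, q) G'"
  by (rule trans[OF fun_cong[OF weight_unfold]], auto simp: weight_step_def)+

lemma weight_unique:
  assumes w: "w = weight_step m w"
  shows "w = weight m"
proof (rule antisym)
  have weight: "weight m G = weight_step m (weight m) G" for G
    by (rule fun_cong[OF weight_unfold])
  have sol: "w G = weight_step m w G" for G
    by (rule fun_cong[OF w])
  have "weight_step m w G \<le> enat n" if "weight_step m (weight m) G \<le> enat n" for n G
    using that
  proof (induction n arbitrary: G)
    case (0 G)
    then show ?case
      by (cases m; cases G)
        (auto simp: weight_step_def zero_enat_def[symmetric] split: if_splits)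
  next
    case (Suc n G)
    have *: "1 + x \<le> enat (Suc n) \<longleftrightarrow> x \<le> enat n" for x :: enat
      by (cases x) (auto simp: one_enat_def)
    have IH: "w G \<le> enat n" if "weight m G \<le> enat n" for G
      using Suc.IH[of G] that unfolding weight[of G] sol[of G] .
    show ?case
      using Suc.prems
      by (cases m; cases G)
        (auto simp: weight_step_def * SUP_le_iff intro: IH split: if_splits)
  qed
  then have le: "w G \<le> enat n" if "weight m G \<le> enat n" for n G
    using that unfolding weight[of G] sol[of G] .
  show "w \<le> weight m"
  proof (rule le_funI)
    fix G show "w G \<le> weight m G"
      using le[of G] by (cases "weight m G") auto
  qed
  show "weight m \<le> w"
    unfolding weight_def by (rule lfp_lowerbound, rule eq_refl, rule w[symmetric])
qed

definition sound :: "'p set \<Rightarrow> ('p, 'l) gtype \<Rightarrow> ('p, 'l) queue \<Rightarrow> bool" where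
  "sound \<P> G M \<longleftrightarrow>
     (\<forall>p l q. (p, l, q) \<in> messages M \<and> {p, q} \<subseteq> \<P> \<longrightarrow> weight (p, l, q) G \<noteq> \<infinity>)"


section \<open>Typing\<close>

text \<open>
  Histories are finite in every derivation that starts from the empty one. Both \<open>Out\<close> and \<open>In\<close>
  extend the history with the session and the global type of their conclusion. In particular, the
  queue recorded by \<open>In\<close> contains the message about to be read: recording only the remaining queue
  \<open>M\<close> would let \<open>Cycle\<close> close a loop in which that message is consumed but never produced again, so
  that messages of \<open>M\<close> that are to be read later may become orphans.
\<close>

type_synonym ('p, 'l) history = "(('p, 'l) session \<times> ('p, 'l) gtype) set"

inductive typing ::
  "'p set \<Rightarrow> ('p, 'l) history \<Rightarrow> ('p, 'l) gtype \<Rightarrow> ('p, 'l) network \<Rightarrow> ('p, 'l) queue \<Rightarrow> bool"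
  for \<P> :: "'p set" where
  End: "net_plays N \<inter> \<P> = {} \<Longrightarrow> sound \<P> End M \<Longrightarrow> typing \<P> H End N M"
| Cycle: "((N, M), G) \<in> H \<Longrightarrow> typing \<P> H G N M"
| Out: "typing \<P> H G (N(p := P)) M"
  if "G = GSend p q Gs"
    and "P = Send q Ps"
    and "fmdom Gs = fmdom Ps"
    and "N p = Inact"
    and "sound \<P> G M"
    and "\<And>M'. ((N(p := P), M'), G) \<notin> H"
    and "(net_plays N - gplays G) \<inter> \<P> = {}"
    and "\<And>l G' P'. fmlookup Gs l = Some G' \<Longrightarrow> fmlookup Ps l = Some P' \<Longrightarrow>
           typing \<P> (insert ((N(p := P), M), G) H) G' (N(p := P')) (M \<odot> single (p, l, q))"
| In: "typing \<P> H G (N(p := P)) (single (q, l, p) \<odot> M)"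
  if "G = GRecv p q l G'"
    and "P = Recv q Ps"
    and "fmlookup Ps l = Some P'"
    and "N p = Inact"
    and "sound \<P> G' M"
    and "\<And>M'. ((N(p := P), M'), G) \<notin> H"
    and "(net_plays N - gplays G) \<inter> \<P> = {}"
    and "typing \<P> (insert ((N(p := P), single (q, l, p) \<odot> M), G) H) G' (N(p := P')) M"

end

theory Submission
  imports Defs
begin

text \<open>
  Cycles in finite derivations unfold to a coinductive typing without histories. There, soundness at
  every node shows that each path of the global type reads at least as many messages from \<open>p\<close> to
  \<open>q\<close> as the queue contains, for \<open>p\<close> and \<open>q\<close> in \<open>\<P>\<close>. Unlike soundness itself, which considers a
  message as if it were the first one between its participants, this counting condition survives
  transitions. When a participant moves, its first action is erased from every path of the global
  type on which it occurs; participants outside \<open>\<P>\<close> may be missing from some paths, so boundedness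
  is not preserved, but the weaker property \<open>acts\<close> of all subterms is, and it makes the erasure
  well-founded. Finally, following the global type until the first read from \<open>p\<close> by \<open>q\<close> consumes
  the message at the head of the queue.
\<close>

section \<open>Queues as families of channels\<close>

text \<open>Swapped neighbours differ in sender or receiver, so at most one of them survives the
  filter and the result does not depend on the representative. A read then concerns only the head of
  one list.\<close>

lift_definition channel :: "('p, 'l) queue \<Rightarrow> 'p \<times> 'p \<Rightarrow> 'l list"
  is "\<lambda>ms (p, q). map (\<lambda>(r, l, s). l) (filter (\<lambda>(r, l, s). r = p \<and> s = q) ms)"
proof -
  fix ms ms' :: "('p, 'l) message list"
  let ?ch = "\<lambda>ms (p, q). map (\<lambda>(r, l, s). l) (filter (\<lambda>(r, l, s). r = p \<and> s = q) ms)"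
  have swap: "?ch xs = ?ch ys" if "queue_swap xs ys" for xs ys :: "('p, 'l) message list"
    using that by cases auto
  assume "queue_equiv ms ms'"
  then show "?ch ms = ?ch ms'"
    by (induction rule: equivclp_induct) (metis swap)+
qed

lemma channel_append: "channel (M \<odot> M') c = channel M c @ channel M' c"
  by transfer auto

lemma channel_single: "channel (single (p, l, q)) c = (if c = (p, q) then [l] else [])"
  by (cases c, transfer fixing: p l q c) auto

lemma channel_enqueue:
  "channel (M \<odot> single (p, l, q)) = (channel M)((p, q) := channel M (p, q) @ [l])"
  by (auto simp: channel_append channel_single)

lemma channel_dequeue:
  "channel (single (q, l, p) \<odot> M) (q, p) = l # channel M (q, p)"
  "channel M = (channel (single (q, l, p) \<odot> M))((q, p) := channel M (q, p))"
  by (auto simp: channel_append channel_single)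

lemma in_messages_iff: "(p, l, q) \<in> messages M \<longleftrightarrow> l \<in> set (channel M (p, q))"
  by (transfer fixing: p l q) force

lemma queue_equiv_to_front:
  assumes "\<And>r l' s. (r, l', s) \<in> set us \<Longrightarrow> r \<noteq> p \<or> s \<noteq> q"
  shows "queue_equiv (us @ (p, l, q) # vs) ((p, l, q) # us @ vs)"
  using assms
proof (induction us)
  case Nil
  then show ?case by simp
next
  case (Cons u us)
  obtain r l' s where u: "u = (r, l', s)" by (cases u)
  have "queue_equiv (us @ (p, l, q) # vs) ((p, l, q) # us @ vs)"
    using Cons.IH Cons.prems by (meson list.set_intros(2))
  then have "queue_equiv (u # us @ (p, l, q) # vs) (u # (p, l, q) # us @ vs)"
    using queue_equiv_append[of _ _ "[u]" "[]"] by fastforce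
  moreover have "queue_swap (u # (p, l, q) # us @ vs) ((p, l, q) # u # us @ vs)"
    using queue_swap.intros[of r p s q "[]" l' l "us @ vs"] Cons.prems u by auto
  ultimately show ?case
    by (simp add: equivclp_into_equivclp)
qed

text \<open>The first message from \<open>p\<close> to \<open>q\<close> is preceded only by messages
  of other channels, so swaps bring it to the front of the queue.\<close>

lemma channel_ConsE:
  assumes "channel M (p, q) = l # ls"
  obtains M' where "M = single (p, l, q) \<odot> M'"
proof -
  have "\<exists>M'. M = single (p, l, q) \<odot> M'"
    using assms
  proof (transfer fixing: p q l ls, goal_cases)
    case (1 ms)
    then obtain m xs where m: "filter (\<lambda>(r, l, s). r = p \<and> s = q) ms = m # xs"
      and l: "(case m of (r, l, s) \<Rightarrow> l) = l"
      by auto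
    then obtain us vs where ms: "ms = us @ m # vs"
      and us: "\<forall>u\<in>set us. \<not> (case u of (r, l, s) \<Rightarrow> r = p \<and> s = q)"
      and "case m of (r, l, s) \<Rightarrow> r = p \<and> s = q"
      by (auto simp: filter_eq_Cons_iff)
    with l have "m = (p, l, q)" by auto
    with us queue_equiv_to_front[of us p q l vs] show ?case
      by (auto simp: ms)
  qed
  with that show thesis by blast
qed


section \<open>Participants and reads on the paths of a global type\<close>

text \<open>Being inductive, \<open>acts x G\<close> says that every path leads in finitely many
  steps to an action of \<open>x\<close> or to a subterm without \<open>x\<close>. Different
  branches may end differently, which finite depth would forbid.\<close>

inductive acts :: "'p \<Rightarrow> ('p, 'l) gtype \<Rightarrow> bool" for x where
  absent: "x \<notin> gplays G \<Longrightarrow> acts x G"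
| send_head: "acts x (GSend x q Gs)"
| recv_head: "acts x (GRecv x q l G)"
| send: "(\<And>l G. fmlookup Gs l = Some G \<Longrightarrow> acts x G) \<Longrightarrow> p \<noteq> x \<Longrightarrow> acts x (GSend p q Gs)"
| recv: "acts x G \<Longrightarrow> p \<noteq> x \<Longrightarrow> acts x (GRecv p q l G)"

lemma gplays_simps [simp]:
  "gplays End = {}"
  "x \<in> gplays (GSend p q Gs) \<longleftrightarrow> x = p \<or> (\<exists>l G. fmlookup Gs l = Some G \<and> x \<in> gplays G)"
  "x \<in> gplays (GRecv p q l G') \<longleftrightarrow> x = p \<or> x \<in> gplays G'"
  by (auto simp: gplays_def elim: in_gplays.cases intro: in_gplays.intros)

text \<open>The path always enters a branch on which \<open>acts x\<close> fails again. It is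
  meaningful only if \<open>acts x G\<close> fails; otherwise such a branch may not exist and the
  choice is arbitrary.\<close>

primcorec avoiding_path :: "'p \<Rightarrow> ('p, 'l) gtype \<Rightarrow> ('p, 'l) comm llist" where
  "avoiding_path x G = (case G of
      End \<Rightarrow> LNil
    | GSend p q Gs \<Rightarrow>
        LCons (CSend p q (SOME l. \<exists>G'. fmlookup Gs l = Some G' \<and> \<not> acts x G'))
          (avoiding_path x
            (the (fmlookup Gs (SOME l. \<exists>G'. fmlookup Gs l = Some G' \<and> \<not> acts x G'))))
    | GRecv p q l G' \<Rightarrow> LCons (CRecv p q l) (avoiding_path x G'))"

lemma not_acts_cases:
  assumes "\<not> acts x G"
  obtains p q l Gs G' where "G = GSend p q Gs" "fmlookup Gs l = Some G'" "\<not> acts x G'" "p \<noteq> x"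
      "avoiding_path x G = LCons (CSend p q l) (avoiding_path x G')"
  | p q l G' where "G = GRecv p q l G'" "\<not> acts x G'" "p \<noteq> x"
      "avoiding_path x G = LCons (CRecv p q l) (avoiding_path x G')"
proof (cases G)
  case End
  then have "acts x G" by (simp add: acts.absent)
  with assms show thesis by simp
next
  case (GSend p q Gs)
  let ?l = "SOME l. \<exists>G'. fmlookup Gs l = Some G' \<and> \<not> acts x G'"
  have "p \<noteq> x" and "\<exists>l G'. fmlookup Gs l = Some G' \<and> \<not> acts x G'"
    using assms acts.send_head acts.send unfolding GSend by metis+
  from someI_ex[OF this(2)] obtain G' where "fmlookup Gs ?l = Some G'" "\<not> acts x G'" by blast
  with \<open>p \<noteq> x\<close> GSend show thesis
    by (intro that(1)[of p q Gs ?l G']) (auto simp: avoiding_path.code[of x "GSend p q Gs"])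
next
  case (GRecv p q l G')
  with assms show thesis
    by (intro that(2)[of p q l G']) (auto simp: avoiding_path.code[of x "GRecv p q l G'"] intro: acts.intros)
qed

lemma avoiding_path_is_path:
  assumes "\<not> acts x G"
  shows "is_path G (avoiding_path x G)"
proof -
  have "\<exists>x. \<not> acts x G \<and> \<xi> = avoiding_path x G \<Longrightarrow> is_path G \<xi>" for \<xi>
  proof (coinduction arbitrary: G \<xi>)
    case is_path
    then obtain x where "\<not> acts x G" "\<xi> = avoiding_path x G" by blast
    then show ?case by (cases rule: not_acts_cases) auto
  qed
  with assms show ?thesis by blast
qed

lemma avoiding_path_avoids:
  assumes "\<not> acts x G" "lnth_opt (avoiding_path x G) n = Some b"
  shows "play b \<noteq> x"
  using assms
proof (induction n arbitrary: G rule: less_induct)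
  case (less n)
  \<comment> \<open>Positions are counted from 1, so position 0 holds no communication.\<close>
  consider "n = 1" | m where "n = Suc (Suc m)"
    using less.prems(2) by (metis One_nat_def lnth_opt.simps(1) not0_implies_Suc option.distinct(1))
  then show ?case
    using less.prems(1)
  proof cases
    case 1
    with less.prems(2) show ?thesis
      by (cases rule: not_acts_cases[OF less.prems(1)]) auto
  next
    case (2 m)
    with less.prems(2) less.IH[of "Suc m"] show ?thesis
      by (cases rule: not_acts_cases[OF less.prems(1)]) auto
  qed
qed

text \<open>By contraposition: if \<open>acts x G\<close> fails, then \<open>x\<close> plays in
  \<open>G\<close> by rule \<open>absent\<close>, so the default depth 0 does not apply, and the
  avoiding path forces the supremum to be infinite.\<close>

lemma acts_if_depth_finite:
  assumes "depth G x \<noteq> \<infinity>"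
  shows "acts x G"
proof (rule ccontr)
  assume *: "\<not> acts x G"
  then have "x \<in> gplays G" by (auto intro: acts.absent)
  have "path_depth (avoiding_path x G) x = \<infinity>"
    using avoiding_path_avoids[OF *] by (auto simp: path_depth_def Inf_enat_def)
  moreover have "path_depth (avoiding_path x G) x \<le> depth G x"
    using avoiding_path_is_path[OF *] \<open>x \<in> gplays G\<close>
    by (auto simp: depth_def paths_def intro: SUP_upper)
  ultimately show False using assms by simp
qed

lemma gplays_subtypes: "G' \<in> subtypes G \<Longrightarrow> gplays G' \<subseteq> gplays G"
proof (induction rule: subtypes.induct)
  case (2 p q Gs l G')
  then have "gplays G' \<subseteq> gplays (GSend p q Gs)" by auto
  with 2 show ?case by blast
qed auto

lemma acts_if_bounded:
  assumes "bounded G" "G' \<in> subtypes G"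
  shows "acts x G'"
proof (cases "x \<in> gplays G'")
  case True
  then have "depth G' x \<noteq> \<infinity>"
    using assms gplays_subtypes[OF assms(2)] unfolding bounded_def by blast
  then show ?thesis by (rule acts_if_depth_finite)
qed (rule acts.absent)

text \<open>A lower bound on the reads by \<open>q\<close> from \<open>p\<close> along every path,
  reached after finitely many steps. Labels are ignored here; \<open>wt\<close> makes them match the
  queue.\<close>

inductive reads :: "'p \<Rightarrow> 'p \<Rightarrow> nat \<Rightarrow> ('p, 'l) gtype \<Rightarrow> bool" for p q where
  zero: "reads p q 0 G"
| read: "reads p q n G \<Longrightarrow> reads p q (Suc n) (GRecv q p l G)"
| recv: "reads p q n G \<Longrightarrow> r \<noteq> q \<or> s \<noteq> p \<Longrightarrow> reads p q n (GRecv r s l G)"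
| send: "(\<And>l G. fmlookup Gs l = Some G \<Longrightarrow> reads p q n G) \<Longrightarrow> reads p q n (GSend r s Gs)"

lemma reads_mono: "reads p q n G \<Longrightarrow> m \<le> n \<Longrightarrow> reads p q m G"
proof (induction arbitrary: m rule: reads.induct)
  case (read n G l)
  then show ?case by (cases m) (auto intro: reads.intros)
qed (auto intro: reads.intros)


section \<open>Typing without histories\<close>

text \<open>A parameterised coinductive reading of the typing rules: the history \<open>H\<close> consists of
  judgements that may be used below a rule, and it is discharged by \<open>pretyping_discharge\<close>.\<close>

coinductive pretyping ::
  "'p set \<Rightarrow> ('p, 'l) history \<Rightarrow> ('p, 'l) gtype \<Rightarrow> ('p, 'l) network \<Rightarrow> ('p, 'l) queue \<Rightarrow> bool"
  for \<P> H where
  End: "net_plays N \<inter> \<P> = {} \<Longrightarrow> sound \<P> End M \<Longrightarrow> pretyping \<P> H End N M"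
| Out: "pretyping \<P> H (GSend p q Gs) N M"
  if "N p = Send q Ps"
    and "fmdom Gs = fmdom Ps"
    and "sound \<P> (GSend p q Gs) M"
    and "net_plays N \<inter> \<P> \<subseteq> gplays (GSend p q Gs)"
    and "\<forall>l G P. fmlookup Gs l = Some G \<longrightarrow> fmlookup Ps l = Some P \<longrightarrow>
      pretyping \<P> H G (N(p := P)) (M \<odot> single (p, l, q)) \<or>
      ((N(p := P), M \<odot> single (p, l, q)), G) \<in> H"
| In: "pretyping \<P> H (GRecv p q l G) N (single (q, l, p) \<odot> M)"
  if "N p = Recv q Ps"
    and "fmlookup Ps l = Some P"
    and "sound \<P> G M"
    and "net_plays N \<inter> \<P> \<subseteq> gplays (GRecv p q l G)"
    and "pretyping \<P> H G (N(p := P)) M \<or> ((N(p := P), M), G) \<in> H"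

text \<open>Each appeal to the inserted judgement can be replaced by the whole derivation of that
  judgement. This is sound because \<open>pretyping\<close> consults the history only below a rule,
  so every unfolding is guarded.\<close>

lemma pretyping_discharge:
  assumes "pretyping \<P> (insert ((N, M), G) H) G N M"
  shows "pretyping \<P> H G N M"
proof -
  have "pretyping \<P> (insert ((N, M), G) H) G' N' M' \<Longrightarrow> pretyping \<P> H G' N' M'" for G' N' M'
  proof (coinduction arbitrary: G' N' M')
    case pretyping
    then show ?case
    proof cases
      case (Out p q Ps Gs)
      then show ?thesis using assms by fastforce
    next
      case (In p q Ps l P G M)
      then show ?thesis using assms by fastforce
    qed simp
  qed
  with assms show ?thesis by blast
qed

text \<open>The second alternative covers \<open>Cycle\<close> at the root, and it is void for the
  empty history. In the other cases the judgement is built with itself in the history, which is then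
  discharged.\<close>

lemma typing_imp_pretyping:
  "typing \<P> H G N M \<Longrightarrow> pretyping \<P> H G N M \<or> ((N, M), G) \<in> H"
proof (induction rule: typing.induct)
  case (End N M H)
  then show ?case by (auto intro: pretyping.End)
next
  case (Cycle N M G H)
  then show ?case by simp
next
  case (Out G p q Gs P Ps N M H)
  have "pretyping \<P> (insert ((N(p := P), M), G) H) (GSend p q Gs) (N(p := P)) M"
  proof (rule pretyping.Out[of _ _ _ Ps])
    \<comment> \<open>The side condition of the rule speaks of \<open>N\<close> without
      \<open>p\<close>; the participant \<open>p\<close> itself plays at the head of the
      type.\<close>
    show "net_plays (N(p := P)) \<inter> \<P> \<subseteq> gplays (GSend p q Gs)"
      using Out.hyps by (auto simp: net_plays_def split: if_splits)
  next
    show "\<forall>l G' P'. fmlookup Gs l = Some G' \<longrightarrow> fmlookup Ps l = Some P' \<longrightarrow>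
      pretyping \<P> (insert ((N(p := P), M), G) H) G' ((N(p := P))(p := P')) (M \<odot> single (p, l, q)) \<or>
      (((N(p := P))(p := P'), M \<odot> single (p, l, q)), G') \<in> insert ((N(p := P), M), G) H"
      unfolding fun_upd_upd using Out.IH by blast
  qed (use Out.hyps in auto)
  with Out.hyps(1) pretyping_discharge show ?case by blast
next
  case (In G p q l G' P Ps P' N M H)
  let ?M = "single (q, l, p) \<odot> M"
  have "pretyping \<P> (insert ((N(p := P), ?M), G) H) (GRecv p q l G') (N(p := P)) ?M"
  proof (rule pretyping.In[of _ _ _ Ps _ P'])
    show "net_plays (N(p := P)) \<inter> \<P> \<subseteq> gplays (GRecv p q l G')"
      using In.hyps by (auto simp: net_plays_def split: if_splits)
    show "pretyping \<P> (insert ((N(p := P), ?M), G) H) G' ((N(p := P))(p := P')) M \<or>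
      (((N(p := P))(p := P'), M), G') \<in> insert ((N(p := P), ?M), G) H"
      unfolding fun_upd_upd by (rule In.IH)
  qed (use In.hyps in auto)
  with In.hyps(1) pretyping_discharge show ?case by blast
qed

section \<open>From soundness to a number of reads\<close>

lemma SUP_enat_finite_upper:
  fixes f :: "'a \<Rightarrow> enat"
  assumes "1 + (SUP x\<in>A. f x) = enat k" "x \<in> A"
  obtains j where "f x = enat j" "j < k"
proof -
  have "1 + f x \<le> enat k"
    unfolding assms(1)[symmetric] using assms(2) by (intro add_left_mono SUP_upper)
  with that show thesis
    by (cases "f x") (auto simp: one_enat_def)
qed

text \<open>The outer induction is on the number of messages counted, the inner one on the weight of
  one of them. Finite weight leads every path to a read on this channel; that read removes one
  message, and soundness further below takes care of the remaining ones.\<close>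

lemma pretyping_reads:
  fixes G :: "('p, 'l) gtype"
  assumes "pretyping \<P> {} G N M" "p \<in> \<P>" "q \<in> \<P>" "n \<le> length (channel M (p, q))"
  shows "reads p q n G"
  using assms
proof (induction n arbitrary: G N M)
  case 0
  then show ?case by (rule_tac reads.zero)
next
  case (Suc n)
  have finite_weight: "reads p q (Suc n) G"
    if "weight (p, l, q) G = enat k" "pretyping \<P> {} G N M" "Suc n \<le> length (channel M (p, q))"
    for l k N M and G :: "('p, 'l) gtype"
    using that
  proof (induction k arbitrary: G N M rule: less_induct)
    case (less k)
    from less.prems(2) show ?case
    proof cases
      case End
      with less.prems show ?thesis by (simp add: weight_simps)
    next
      case (Out p' q' Ps Gs)
      show ?thesis
        unfolding Out
      proof (rule reads.send)
        fix l' G'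
        assume G': "fmlookup Gs l' = Some G'"
        then obtain P where P: "fmlookup Ps l' = Some P"
          using Out(3) by (metis fmdomI fmdomE)
        obtain j where "weight (p, l, q) G' = enat j" "j < k"
          using less.prems(1) G' unfolding Out weight_simps
          by (rule_tac SUP_enat_finite_upper[of "weight (p, l, q)" "fmran' Gs" k G'])
            (auto intro: fmran'I)
        moreover have "pretyping \<P> {} G' (N(p' := P)) (M \<odot> single (p', l', q'))"
          using Out G' P by blast
        ultimately show "reads p q (Suc n) G'"
          using less.prems(3) less.IH by (simp add: channel_append)
      qed
    next
      case (In p' q' Ps l' P G' M')
      show ?thesis
      proof (cases "p' = q \<and> q' = p")
        case True
        have "pretyping \<P> {} G' (N(p' := P)) M'" using In by simp
        moreover have "n \<le> length (channel M' (p, q))"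
          using In True less.prems(3) by (simp add: channel_dequeue)
        ultimately have "reads p q n G'" using Suc.IH Suc.prems(2,3) by blast
        with In True show ?thesis by (simp add: reads.read)
      next
        case False
        with less.prems(1) In obtain j where "weight (p, l, q) G' = enat j" "j < k"
          by (cases "weight (p, l, q) G'") (auto simp: weight_simps one_enat_def)
        moreover have "pretyping \<P> {} G' (N(p' := P)) M'" using In by simp
        moreover have "Suc n \<le> length (channel M' (p, q))"
          using In False less.prems(3) by (auto simp: channel_append channel_single)
        ultimately have "reads p q (Suc n) G'" using less.IH by blast
        with False In show ?thesis by (auto intro: reads.recv)
      qed
    qed
  qed
  \<comment> \<open>The channel has length at least \<open>Suc n\<close>, so it contains a message
    to which soundness applies.\<close>
  obtain l where l: "(p, l, q) \<in> messages M"
    using Suc.prems(4) by (cases "channel M (p, q)") (auto simp: in_messages_iff)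
  from Suc.prems(1) show ?case
  proof cases
    case End
    with l Suc.prems show ?thesis by (auto simp: sound_def weight_simps)
  next
    case (Out p' q' Ps Gs)
    with l Suc.prems have "weight (p, l, q) G \<noteq> \<infinity>" by (auto simp: sound_def)
    with finite_weight Suc.prems show ?thesis by blast
  next
    \<comment> \<open>Rule \<open>In\<close> gives soundness of the continuation only, so this first
      step is treated before \<open>finite_weight\<close> is applied.\<close>
    case (In p' q' Ps l' P G' M')
    show ?thesis
    proof (cases "p' = q \<and> q' = p")
      case True
      have "pretyping \<P> {} G' (N(p' := P)) M'" using In by simp
      moreover have "n \<le> length (channel M' (p, q))"
        using In True Suc.prems(4) by (simp add: channel_dequeue)
      ultimately have "reads p q n G'" using Suc.IH Suc.prems(2,3) by blast
      with In True show ?thesis by (simp add: reads.read)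
    next
      case False
      with l In have "(p, l, q) \<in> messages M'"
        by (auto simp: in_messages_iff channel_append channel_single split: if_splits)
      with In Suc.prems have "weight (p, l, q) G' \<noteq> \<infinity>" by (auto simp: sound_def)
      moreover have "Suc n \<le> length (channel M' (p, q))"
        using In False Suc.prems(4) by (auto simp: channel_append channel_single)
      ultimately have "reads p q (Suc n) G'"
        using finite_weight In by blast
      with False In show ?thesis by (auto intro: reads.recv)
    qed
  qed
qed


section \<open>The invariant\<close>

text \<open>Any participant may move, hence \<open>acts\<close> for all \<open>x\<close>. The second
  conjunct places a mover that is absent from \<open>G\<close> outside \<open>\<P>\<close>; the
  third is the counting condition.\<close>

definition adequate ::
  "'p set \<Rightarrow> ('p, 'l) gtype \<Rightarrow> ('p, 'l) network \<Rightarrow> ('p \<times> 'p \<Rightarrow> 'l list) \<Rightarrow> bool" where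
  "adequate \<P> G N C \<longleftrightarrow> (\<forall>x. acts x G) \<and> net_plays N \<inter> \<P> \<subseteq> gplays G \<and>
     (\<forall>p\<in>\<P>. \<forall>q\<in>\<P>. reads p q (length (C (p, q))) G)"

text \<open>Well-formedness of the type is not tracked through transitions, so nonemptiness of
  choices is recorded in rule \<open>Out\<close>. It guarantees a branch to follow in
  \<open>wt_reads_message\<close>.\<close>

coinductive wt ::
  "'p set \<Rightarrow> ('p, 'l) gtype \<Rightarrow> ('p, 'l) network \<Rightarrow> ('p \<times> 'p \<Rightarrow> 'l list) \<Rightarrow> bool"
  for \<P> where
  End: "adequate \<P> End N C \<Longrightarrow> wt \<P> End N C"
| Out: "wt \<P> (GSend p q Gs) N C"
  if "adequate \<P> (GSend p q Gs) N C"
    and "N p = Send q Ps"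
    and "fmdom Gs = fmdom Ps"
    and "Gs \<noteq> fmempty"
    and "\<forall>l G P. fmlookup Gs l = Some G \<longrightarrow> fmlookup Ps l = Some P \<longrightarrow>
      wt \<P> G (N(p := P)) (C((p, q) := C (p, q) @ [l]))"
| In: "wt \<P> (GRecv p q l G) N C"
  if "adequate \<P> (GRecv p q l G) N C"
    and "N p = Recv q Ps"
    and "fmlookup Ps l = Some P"
    and "C (q, p) = l # ls"
    and "wt \<P> G (N(p := P)) (C((q, p) := ls))"

lemma wt_adequate: "wt \<P> G N C \<Longrightarrow> adequate \<P> G N C"
  by (erule wt.cases) auto

text \<open>The coinduction ranges over the subterms of a fixed \<open>G0\<close>, whose boundedness
  yields \<open>acts\<close> and whose well-formedness yields nonempty choices at each of
  them.\<close>

lemma pretyping_imp_wt: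
  fixes G :: "('p, 'l) gtype"
  assumes "wf_gtype G0" "bounded G0" "G \<in> subtypes G0" "pretyping \<P> {} G N M"
  shows "wt \<P> G N (channel M)"
proof -
  define X where "X G N C \<longleftrightarrow> G \<in> subtypes G0 \<and> (\<exists>M. C = channel M \<and> pretyping \<P> {} G N M)"
    for G :: "('p, 'l) gtype" and N C
  have "X G N C \<Longrightarrow> wt \<P> G N C" for C
  proof (coinduction arbitrary: G N C)
    case wt
    then obtain M where G: "G \<in> subtypes G0" and C: "C = channel M" and pre: "pretyping \<P> {} G N M"
      unfolding X_def by blast
    from pre have "net_plays N \<inter> \<P> \<subseteq> gplays G" by cases auto
    with pre G have adequate: "adequate \<P> G N C"
      by (auto simp: adequate_def C acts_if_bounded[OF assms(2)] intro: pretyping_reads)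
    from pre show ?case
    proof cases
      case End
      with adequate show ?thesis by simp
    next
      case (Out p q Ps Gs)
      have "Gs \<noteq> fmempty"
        using Out assms(1) G by (auto simp: wf_gtype_def)
      moreover have "X G' (N(p := P)) (C((p, q) := C (p, q) @ [l]))"
        if "fmlookup Gs l = Some G'" "fmlookup Ps l = Some P" for l G' P
        unfolding X_def
      proof (intro conjI exI)
        show "G' \<in> subtypes G0"
          using that(1) Out(1) G subtypes.intros(2) by metis
        show "C((p, q) := C (p, q) @ [l]) = channel (M \<odot> single (p, l, q))"
          by (simp only: C channel_enqueue)
        show "pretyping \<P> {} G' (N(p := P)) (M \<odot> single (p, l, q))"
          using Out that by blast
      qed
      ultimately show ?thesis
        using Out adequate by simp
    next
      case (In p q Ps l P G' M')
      have "G' \<in> subtypes G0"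
        using In(1) G subtypes.intros(3) by metis
      have C': "C (q, p) = l # channel M' (q, p)"
        "channel M' = C((q, p) := channel M' (q, p))"
        unfolding C In by (rule channel_dequeue)+
      have "X G' (N(p := P)) (C((q, p) := channel M' (q, p)))"
        unfolding X_def C'(2)[symmetric] using In \<open>G' \<in> subtypes G0\<close> by blast
      with C'(1) show ?thesis
        using In adequate by simp
    qed
  qed
  with assms show ?thesis unfolding X_def by blast
qed


section \<open>Preservation under transitions\<close>

text \<open>On channels no queue equivalence is left, so commuting two steps reduces to equalities
  of function updates.\<close>

inductive cstep :: "'p \<Rightarrow> ('p, 'l) network \<Rightarrow> ('p \<times> 'p \<Rightarrow> 'l list) \<Rightarrow>
    ('p, 'l) network \<Rightarrow> ('p \<times> 'p \<Rightarrow> 'l list) \<Rightarrow> bool" for p where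
  send: "N p = Send q Ps \<Longrightarrow> fmlookup Ps l = Some P \<Longrightarrow>
    cstep p N C (N(p := P)) (C((p, q) := C (p, q) @ [l]))"
| recv: "N p = Recv q Ps \<Longrightarrow> fmlookup Ps l = Some P \<Longrightarrow> C (q, p) = l # ls \<Longrightarrow>
    cstep p N C (N(p := P)) (C((q, p) := ls))"

lemma step_imp_cstep:
  assumes "step (N, M) b (N', M')"
  shows "cstep (play b) N (channel M) N' (channel M')"
  using assms
proof cases
  case (Send N0 p Ps l P q)
  then show ?thesis
    using cstep.send[of N p q Ps l P "channel M"] by (simp add: channel_enqueue)
next
  case (Rcv N0 p Ps l P q)
  then show ?thesis
    using cstep.recv[of N p q Ps l P "channel M" "channel M' (q, p)"]
    by (simp add: channel_dequeue(1) channel_dequeue(2)[of M' q l p, symmetric])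
qed

lemma cstep_active: "cstep p N C N' C' \<Longrightarrow> p \<in> net_plays N"
  by (erule cstep.cases) (auto simp: net_plays_def)

lemma cstep_other: "cstep p N C N' C' \<Longrightarrow> r \<noteq> p \<Longrightarrow> N' r = N r"
  by (erule cstep.cases) auto

text \<open>Distinct senders write to distinct channels. If \<open>p\<close> reads the channel that
  \<open>r\<close> extends, one step acts on the head and the other on the end of a nonempty
  list.\<close>

lemma cstep_commute_send:
  assumes "cstep p N C N' C'" "r \<noteq> p"
  shows "cstep p (N(r := P)) (C((r, s) := C (r, s) @ [l])) (N'(r := P)) (C'((r, s) := C' (r, s) @ [l]))"
  using assms(1)
proof cases
  case (send q Ps l' P')
  then show ?thesis
    using assms(2) cstep.send[of "N(r := P)" p q Ps l' P' "C((r, s) := C (r, s) @ [l])"]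
    by (simp add: fun_upd_twist)
next
  case (recv q Ps l' P' ls)
  show ?thesis
  proof (cases "(r, s) = (q, p)")
    case True
    then show ?thesis
      using recv assms(2) cstep.recv[of "N(r := P)" p q Ps l' P' "C((r, s) := C (r, s) @ [l])" "ls @ [l]"]
      by (simp add: fun_upd_twist)
  next
    case False
    then show ?thesis
      using recv assms(2) cstep.recv[of "N(r := P)" p q Ps l' P' "C((r, s) := C (r, s) @ [l])" ls]
      by (auto simp: fun_upd_twist)
  qed
qed

text \<open>The step of \<open>p\<close> cannot remove the label awaited by \<open>r\<close>, since
  \<open>p\<close> reads only channels towards itself. It may append to that channel, hence a new
  remainder \<open>ls'\<close>.\<close>

lemma cstep_commute_recv:
  assumes "cstep p N C N' C'" "r \<noteq> p" "C (s, r) = l # ls"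
  obtains ls' where "C' (s, r) = l # ls'"
    "cstep p (N(r := P)) (C((s, r) := ls)) (N'(r := P)) (C'((s, r) := ls'))"
  using assms(1)
proof cases
  case (send q Ps l' P')
  show ?thesis
  proof (cases "(s, r) = (p, q)")
    case True
    then show ?thesis
      using send assms(2,3) that[of "ls @ [l']"]
        cstep.send[of "N(r := P)" p q Ps l' P' "C((s, r) := ls)"]
      by (simp add: fun_upd_twist)
  next
    case False
    then show ?thesis
      using send assms(2,3) that[of ls]
        cstep.send[of "N(r := P)" p q Ps l' P' "C((s, r) := ls)"]
      by (auto simp: fun_upd_twist)
  qed
next
  case (recv q Ps l' P' ls'')
  then show ?thesis
    using assms(2,3) that[of ls]
      cstep.recv[of "N(r := P)" p q Ps l' P' "C((s, r) := ls)" ls'']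
    by (auto simp: fun_upd_twist)
qed

lemma net_plays_fun_upd: "net_plays N \<subseteq> insert p (net_plays (N(p := P)))"
  by (auto simp: net_plays_def)

text \<open>Serves to rebuild adequacy above an erased action. The bound on the players comes from
  any one branch, and the message sent only makes the count below larger than required.\<close>

lemma adequate_Out:
  assumes "Gs \<noteq> fmempty"
    and "\<And>l G. fmlookup Gs l = Some G \<Longrightarrow>
      \<exists>P. adequate \<P> G (N(p := P)) (C((p, q) := C (p, q) @ [l]))"
  shows "adequate \<P> (GSend p q Gs) N C"
proof -
  from assms(1) obtain l G where "fmlookup Gs l = Some G"
    by (metis fmap_ext fmempty_lookup not_None_eq)
  then have "net_plays N \<inter> \<P> \<subseteq> gplays (GSend p q Gs)"
    using assms(2)[of l G] net_plays_fun_upd[of N p] by (fastforce simp: adequate_def)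
  moreover have "reads p' q' (length (C (p', q'))) (GSend p q Gs)" if "p' \<in> \<P>" "q' \<in> \<P>" for p' q'
  proof (rule reads.send)
    fix l G
    assume "fmlookup Gs l = Some G"
    with that assms(2)[of l G]
    have "reads p' q' (length ((C((p, q) := C (p, q) @ [l])) (p', q'))) G"
      unfolding adequate_def by blast
    then show "reads p' q' (length (C (p', q'))) G"
      by (rule reads_mono) auto
  qed
  ultimately show ?thesis
    using assms(2) unfolding adequate_def by (metis acts.send acts.send_head)
qed

text \<open>The read at the head makes up for the message that it removes from channel
  \<open>(q, p)\<close>.\<close>

lemma adequate_In:
  assumes "adequate \<P> G (N(p := P)) (C((q, p) := ls))" "C (q, p) = l # ls"
  shows "adequate \<P> (GRecv p q l G) N C"
proof -
  have "net_plays N \<inter> \<P> \<subseteq> gplays (GRecv p q l G)"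
    using assms(1) net_plays_fun_upd[of N p P] by (fastforce simp: adequate_def)
  moreover have "reads p' q' (length (C (p', q'))) (GRecv p q l G)" if "p' \<in> \<P>" "q' \<in> \<P>" for p' q'
  proof -
    have *: "reads p' q' (length ((C((q, p) := ls)) (p', q'))) G"
      using that assms(1) unfolding adequate_def by blast
    show ?thesis
    proof (cases "p' = q \<and> q' = p")
      case True
      with * assms(2) show ?thesis by (auto intro: reads.read)
    next
      case False
      with * show ?thesis by (auto intro!: reads.recv split: if_splits)
    qed
  qed
  ultimately show ?thesis
    using assms(1) unfolding adequate_def by (metis acts.recv acts.recv_head)
qed

text \<open>There is no action to erase, so \<open>G\<close> itself is kept. Adequacy puts the
  active participant \<open>p\<close> outside \<open>\<P>\<close>, hence its step changes nothing
  that \<open>adequate\<close> observes.\<close>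

lemma wt_cstep_absent:
  fixes G :: "('p, 'l) gtype"
  assumes "wt \<P> G N C" "cstep p N C N' C'" "p \<notin> gplays G"
  shows "wt \<P> G N' C'"
proof -
  define X where "X G N' C' \<longleftrightarrow> (\<exists>N C. wt \<P> G N C \<and> cstep p N C N' C' \<and> p \<notin> gplays G)"
    for G :: "('p, 'l) gtype" and N' C'
  have "X G N' C' \<Longrightarrow> wt \<P> G N' C'"
  proof (coinduction arbitrary: G N' C')
    case wt
    then obtain N C where "wt \<P> G N C" and cstep: "cstep p N C N' C'" and p_G: "p \<notin> gplays G"
      unfolding X_def by blast
    have adequate: "adequate \<P> G N C" using \<open>wt \<P> G N C\<close> by (rule wt_adequate)
    then have p: "p \<notin> \<P>"
      using p_G cstep_active[OF cstep] by (auto simp: adequate_def)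
    have "net_plays N' \<inter> \<P> = net_plays N \<inter> \<P>"
      using p cstep_other[OF cstep] by (fastforce simp: net_plays_def)
    \<comment> \<open>A step of \<open>p\<close> touches only channels with \<open>p\<close> at one
      end.\<close>
    moreover have "C' (r, s) = C (r, s)" if "r \<in> \<P>" "s \<in> \<P>" for r s
      using cstep p that by cases auto
    ultimately have adequate': "adequate \<P> G N' C'"
      using adequate by (auto simp: adequate_def)
    from \<open>wt \<P> G N C\<close> show ?case
    proof cases
      case End
      with adequate' show ?thesis by simp
    next
      case (Out r s Gs Ps)
      then have "r \<noteq> p" using p_G by auto
      then have "N' r = Send s Ps" using Out cstep_other[OF cstep] by simp
      moreover have "X G' (N'(r := P)) (C'((r, s) := C' (r, s) @ [l]))"
        if "fmlookup Gs l = Some G'" "fmlookup Ps l = Some P" for l G' P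
        unfolding X_def
      proof (intro exI conjI)
        show "wt \<P> G' (N(r := P)) (C((r, s) := C (r, s) @ [l]))" using Out that by simp
        show "cstep p (N(r := P)) (C((r, s) := C (r, s) @ [l]))
          (N'(r := P)) (C'((r, s) := C' (r, s) @ [l]))"
          using cstep \<open>r \<noteq> p\<close> by (rule cstep_commute_send)
        show "p \<notin> gplays G'" using that p_G Out by auto
      qed
      ultimately show ?thesis
        using Out adequate' by simp
    next
      case (In r s l G' Ps P ls)
      then have "r \<noteq> p" "p \<notin> gplays G'" using p_G by auto
      then have "N' r = Recv s Ps" using In cstep_other[OF cstep] by simp
      moreover obtain ls' where ls': "C' (s, r) = l # ls'"
        "cstep p (N(r := P)) (C((s, r) := ls)) (N'(r := P)) (C'((s, r) := ls'))"
        using cstep_commute_recv[OF cstep \<open>r \<noteq> p\<close>] In by metis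
      moreover have "X G' (N'(r := P)) (C'((s, r) := ls'))"
        unfolding X_def using In ls'(2) \<open>p \<notin> gplays G'\<close> by blast
      ultimately show ?thesis
        using In adequate' by simp
    qed
  qed
  with assms show ?thesis unfolding X_def by blast
qed

text \<open>Induction on \<open>acts\<close> descends to the first action of \<open>p\<close> on
  each path, where the type continues with the matching branch, or to a subterm without
  \<open>p\<close>. The nodes above are rebuilt, since their actions commute with the step.\<close>

lemma wt_cstep:
  assumes "acts p G" "wt \<P> G N C" "cstep p N C N' C'"
  shows "\<exists>G'. wt \<P> G' N' C'"
  using assms
proof (induction arbitrary: N C N' C' rule: acts.induct)
  case (absent G)
  from wt_cstep_absent[OF absent(2,3,1)] show ?case ..
next
  case (send_head q Gs)
  from send_head(1) obtain Ps where wt: "N p = Send q Ps" "fmdom Gs = fmdom Ps"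
    "\<forall>l G P. fmlookup Gs l = Some G \<longrightarrow> fmlookup Ps l = Some P \<longrightarrow>
      wt \<P> G (N(p := P)) (C((p, q) := C (p, q) @ [l]))"
    by cases auto
  from send_head(2) show ?case
  proof cases
    case (send q' Ps' l P)
    with wt obtain G where "fmlookup Gs l = Some G" by (metis fmdomI fmdomE proc.inject(1))
    with wt send show ?thesis by (metis proc.inject(1))
  qed (use wt in auto)
next
  case (recv_head q l G)
  from recv_head(1) obtain Ps P ls where wt: "N p = Recv q Ps" "fmlookup Ps l = Some P"
    "C (q, p) = l # ls" "wt \<P> G (N(p := P)) (C((q, p) := ls))"
    by cases auto
  \<comment> \<open>The head of channel \<open>(q, p)\<close> determines the label read, so the
    actual step is the one foreseen by the type.\<close>
  from recv_head(2) have "N' = N(p := P)" "C' = C((q, p) := ls)"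
    using wt(1-3) by (cases; auto)+
  with wt(4) show ?case by blast
next
  case (send Gs r s)
  from send.prems(1) obtain Ps where wt: "N r = Send s Ps" "fmdom Gs = fmdom Ps" "Gs \<noteq> fmempty"
    "\<And>l G P. fmlookup Gs l = Some G \<Longrightarrow> fmlookup Ps l = Some P \<Longrightarrow>
      wt \<P> G (N(r := P)) (C((r, s) := C (r, s) @ [l]))"
    by cases auto
  let ?C = "\<lambda>l. C'((r, s) := C' (r, s) @ [l])"
  have ex: "\<exists>G'. wt \<P> G' (N'(r := P)) (?C l)" if "fmlookup Ps l = Some P" for l P
  proof -
    from that wt(2) obtain G where "fmlookup Gs l = Some G" by (metis fmdomI fmdomE)
    with that wt send.IH cstep_commute_send[OF send.prems(2) \<open>r \<noteq> p\<close>] show ?thesis by blast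
  qed
  \<comment> \<open>The erased continuations exist separately for each label; they are chosen
    simultaneously to form one family with the domain of \<open>Ps\<close>.\<close>
  define f where "f l = (SOME G'. wt \<P> G' (N'(r := the (fmlookup Ps l))) (?C l))" for l
  have f: "wt \<P> (f l) (N'(r := P)) (?C l)" if "fmlookup Ps l = Some P" for l P
    using someI_ex[OF ex[OF that]] that by (simp add: f_def)
  define Gs' where "Gs' = fmmap_keys (\<lambda>l _. f l) Ps"
  have Gs': "\<exists>P. fmlookup Ps l = Some P \<and> G' = f l" if "fmlookup Gs' l = Some G'" for l G'
    using that by (auto simp: Gs'_def)
  have "Gs' \<noteq> fmempty"
    using wt(2,3) by (metis Gs'_def fmdom_empty fmdom_fmmap_keys fmrestrict_fset_dom fmrestrict_fset_null)
  moreover have "adequate \<P> (GSend r s Gs') N' C'"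
    using \<open>Gs' \<noteq> fmempty\<close> Gs' f wt_adequate by (metis adequate_Out)
  moreover have "N' r = Send s Ps"
    using wt(1) cstep_other[OF send.prems(2) \<open>r \<noteq> p\<close>] by simp
  ultimately have "wt \<P> (GSend r s Gs') N' C'"
    using f by (intro wt.Out) (auto simp: Gs'_def)
  then show ?case ..
next
  case (recv G r s l)
  from recv.prems(1) obtain Ps P ls where wt: "N r = Recv s Ps" "fmlookup Ps l = Some P"
    "C (s, r) = l # ls" "wt \<P> G (N(r := P)) (C((s, r) := ls))"
    by cases auto
  obtain ls' where ls': "C' (s, r) = l # ls'"
    "cstep p (N(r := P)) (C((s, r) := ls)) (N'(r := P)) (C'((s, r) := ls'))"
    using cstep_commute_recv[OF recv.prems(2) \<open>r \<noteq> p\<close> wt(3)] .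
  from recv.IH[OF wt(4) ls'(2)] obtain G' where G': "wt \<P> G' (N'(r := P)) (C'((s, r) := ls'))" ..
  moreover have "adequate \<P> (GRecv r s l G') N' C'"
    using adequate_In[OF wt_adequate[OF G'] ls'(1)] .
  moreover have "N' r = Recv s Ps"
    using wt(1) cstep_other[OF recv.prems(2) \<open>r \<noteq> p\<close>] by simp
  ultimately have "wt \<P> (GRecv r s l G') N' C'"
    using wt(2) ls'(1) by (blast intro: wt.In)
  then show ?case ..
qed

lemma wt_steps:
  assumes "steps (N, M) t (N', M')" "wt \<P> G N (channel M)"
  shows "\<exists>G'. wt \<P> G' N' (channel M')"
  using assms
proof (induction "(N, M)" t "(N', M')" arbitrary: N M G rule: steps.induct)
  case (Cons b S t)
  obtain N1 M1 where "S = (N1, M1)" by (cases S)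
  moreover have "acts (play b) G"
    using wt_adequate[OF Cons.prems] by (simp add: adequate_def)
  ultimately show ?case
    using Cons wt_cstep step_imp_cstep by metis
qed auto


section \<open>Every message between typed participants is read\<close>

lemma step_sendI:
  assumes "N p = Send q Ps" "fmlookup Ps l = Some P"
  shows "step (N, M) (CSend p q l) (N(p := P), M \<odot> single (p, l, q))"
proof -
  \<comment> \<open>The transition rule adds the component of \<open>p\<close> to a network without
    one, so \<open>p\<close> is cleared first.\<close>
  have "step ((N(p := Inact))(p := Send q Ps), M) (CSend p q l)
      ((N(p := Inact))(p := P), M \<odot> single (p, l, q))"
    by (rule step.Send) (use assms in simp_all)
  with assms(1) show ?thesis by (simp add: fun_upd_idem)
qed

lemma step_recvI:
  assumes "N p = Recv q Ps" "fmlookup Ps l = Some P"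
  shows "step (N, single (q, l, p) \<odot> M) (CRecv p q l) (N(p := P), M)"
proof -
  have "step ((N(p := Inact))(p := Recv q Ps), single (q, l, p) \<odot> M) (CRecv p q l)
      ((N(p := Inact))(p := P), M)"
    by (rule step.Rcv) (use assms in simp_all)
  with assms(1) show ?thesis by (simp add: fun_upd_idem)
qed

text \<open>Until the first read by \<open>q\<close> from \<open>p\<close>, sends only extend the
  channel at its end and other reads concern other channels, so \<open>l\<close> stays at the head.
  The type then forces exactly \<open>l\<close> to be read.\<close>

lemma wt_reads_message:
  assumes "reads p q n G" "0 < n" "wt \<P> G N (channel M)" "channel M (p, q) = l # ls"
  shows "\<exists>t S. steps (N, M) (t @ [CRecv q p l]) S"
  using assms
proof (induction arbitrary: N M ls rule: reads.induct)
  case (zero G)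
  then show ?case by simp
next
  case (read n G l')
  from read.prems(2) obtain Ps P where wt: "N q = Recv p Ps" "fmlookup Ps l = Some P"
    using read.prems(3) by cases auto
  obtain M' where "M = single (p, l, q) \<odot> M'"
    using read.prems(3) by (rule channel_ConsE)
  with wt have "step (N, M) (CRecv q p l) (N(q := P), M')"
    by (simp add: step_recvI)
  then show ?case
    by (metis append_Nil steps.Nil steps.Cons)
next
  case (recv n G r s l')
  from recv.prems(2) obtain Ps P ls' where wt: "N r = Recv s Ps" "fmlookup Ps l' = Some P"
    "channel M (s, r) = l' # ls'" "wt \<P> G (N(r := P)) ((channel M)((s, r) := ls'))"
    by cases auto
  obtain M' where M: "M = single (s, l', r) \<odot> M'"
    using wt(3) by (rule channel_ConsE)
  then have M': "channel M' = (channel M)((s, r) := ls')"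
    using wt(3) channel_dequeue(1)[of s l' r M'] channel_dequeue(2)[where M = M' and q = s and l = l' and p = r] by auto
  have "step (N, M) (CRecv r s l') (N(r := P), M')"
    using wt M by (simp add: step_recvI)
  moreover have "\<exists>t S. steps (N(r := P), M') (t @ [CRecv q p l]) S"
  proof (rule recv.IH)
    show "wt \<P> G (N(r := P)) (channel M')" using wt(4) M' by simp
    show "channel M' (p, q) = l # ls" using recv.prems(3) recv.hyps(2) M' by auto
  qed (rule recv.prems(1))
  ultimately show ?case
    by (metis append_Cons steps.Cons)
next
  case (send Gs n r s)
  from send.prems(2) obtain Ps where wt: "N r = Send s Ps" "fmdom Gs = fmdom Ps" "Gs \<noteq> fmempty"
    "\<And>l G P. fmlookup Gs l = Some G \<Longrightarrow> fmlookup Ps l = Some P \<Longrightarrow>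
      wt \<P> G (N(r := P)) ((channel M)((r, s) := channel M (r, s) @ [l]))"
    by cases auto
  \<comment> \<open>Any branch will do, since \<open>reads\<close> holds for all of them.\<close>
  from wt(3) obtain l' G where G: "fmlookup Gs l' = Some G"
    by (metis fmap_ext fmempty_lookup not_None_eq)
  with wt(2) obtain P where P: "fmlookup Ps l' = Some P" by (metis fmdomI fmdomE)
  let ?M = "M \<odot> single (r, l', s)"
  have "step (N, M) (CSend r s l') (N(r := P), ?M)"
    using wt(1) P by (rule step_sendI)
  moreover have "\<exists>t S. steps (N(r := P), ?M) (t @ [CRecv q p l]) S"
  proof (rule send.IH[OF G])
    show "wt \<P> G (N(r := P)) (channel ?M)" using wt(4)[OF G P] by (simp add: channel_enqueue)
    show "channel ?M (p, q) = l # ls @ channel (single (r, l', s)) (p, q)"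
      using send.prems(3) by (simp add: channel_append)
  qed (rule send.prems(1))
  ultimately show ?case
    by (metis append_Cons steps.Cons)
qed

theorem theorem4:
  fixes \<P> :: "'p set"
    and G :: "('p, 'l) gtype"
    and N :: "('p, 'l) network"
    and M :: "('p, 'l) queue"
  assumes "wf_gtype G"
    and "bounded G"
    and "wf_network N"
    and "typing \<P> {} G N M"
  shows "orphan_message_free \<P> (N, M)"
  unfolding orphan_message_free_def orphan_message_free_pair_def
proof (intro ballI allI impI)
  fix p q :: 'p and t N' M' and l :: 'l
  let ?M = "single (p, l, q) \<odot> M'"
  assume pq: "p \<in> \<P>" "q \<in> \<P>" and steps: "steps (N, M) t (N', ?M)"
  have "pretyping \<P> {} G N M"
    using typing_imp_pretyping[OF assms(4)] by simp
  then have "wt \<P> G N (channel M)"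
    using assms(1,2) subtypes.intros(1) by (rule_tac pretyping_imp_wt)
  with steps obtain G' where G': "wt \<P> G' N' (channel ?M)"
    using wt_steps by blast
  then have "reads p q (length (channel ?M (p, q))) G'"
    using pq wt_adequate[OF G'] by (auto simp: adequate_def)
  \<comment> \<open>The channel starts with \<open>l\<close>, so the number of guaranteed reads is
    positive.\<close>
  with G' show "\<exists>t' S'. steps (N', ?M) (t' @ [CRecv q p l]) S'"
    by (rule_tac wt_reads_message[OF _ _ G']) (auto simp: channel_dequeue)
qed

end
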